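(* Every vector field $v\in\mathscr{B}$ is solenoidal, i.e. ${\rm div}(v)=0$.
   Context: Work over $\mathbb{R}$ with coordinates $(x,y,z)$ and $\Delta:=xz-y^2$. Vector fields (with polynomial or formal power series coefficients) are identified with derivations, with bracket $[v,w]=vw-wv$ and ${\rm ad}_v w=[v,w]$. Let ${\rm N}=x\frac{\partial}{\partial y}+2y\frac{\partial}{\partial z}$, ${\rm M}=z\frac{\partial}{\partial y}+2y\frac{\partial}{\partial x}$, and $\kappa_{l,m}:=\frac{m!}{(m-l)!}$. For integers $i,k\ge 0$, $-1\le l\le 2i+1$, define $${\rm B}^l_{i,k}:=\frac{{\rm ad}_{\rm N}^{\,l+1}(z^i\Delta^k{\rm M})}{\kappa_{l+1,2i+2}}.$$ In particular ${\rm B}^1_{0,0}=-{\rm N}$. The space $\mathscr{B}$ consists of all formal vector fields $c\,{\rm B}^1_{0,0}+\sum b^l_{i,k}{\rm B}^l_{i,k}$ with $c,b^l_{i,k}\in\mathbb R$, the (possibly infinite) sum being over $i,k\ge0$ with $i+2k\ge1$ and $-1\le l\le 2i+1$. *)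

theory Defs
  imports
    "HOL-Computational_Algebra.Formal_Power_Series"
    "HOL-Library.Product_Plus"
begin

unbundle fps_syntax

section \<open>Formal power series in x, y, z over the reals\<close>

text \<open>
  The ring \<open>\<real>[[x,y,z]]\<close> is rendered as \<open>\<real>[[z]][[y]][[x]]\<close>:
  the coefficient of \<open>x^a y^b z^c\<close> in \<open>f\<close> is \<open>f $ a $ b $ c\<close>.
\<close>

type_synonym ps3 = "real fps fps fps"

definition const3 :: "real \<Rightarrow> ps3"
  where "const3 r = fps_const (fps_const (fps_const r))"

definition X :: ps3 where "X = fps_X"
definition Y :: ps3 where "Y = fps_const fps_X"
definition Z :: ps3 where "Z = fps_const (fps_const fps_X)"

definition coeffwise :: "('a \<Rightarrow> 'a) \<Rightarrow> 'a fps \<Rightarrow> 'a fps"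
  where "coeffwise D f = Abs_fps (\<lambda>n. D (f $ n))"

definition dx :: "ps3 \<Rightarrow> ps3" where "dx = fps_deriv"
definition dy :: "ps3 \<Rightarrow> ps3" where "dy = coeffwise fps_deriv"
definition dz :: "ps3 \<Rightarrow> ps3" where "dz = coeffwise (coeffwise fps_deriv)"


section \<open>Formal vector fields\<close>

text \<open>\<open>(P, Q, R)\<close> stands for \<open>P \<partial>/\<partial>x + Q \<partial>/\<partial>y + R \<partial>/\<partial>z\<close>.\<close>

type_synonym vfield = "ps3 \<times> ps3 \<times> ps3"

text \<open>The derivation of the power series ring with which a vector field is identified:\<close>

fun act :: "vfield \<Rightarrow> ps3 \<Rightarrow> ps3"
  where "act (P, Q, R) f = P * dx f + Q * dy f + R * dz f"

fun smult_vf :: "ps3 \<Rightarrow> vfield \<Rightarrow> vfield"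
  where "smult_vf f (P, Q, R) = (f * P, f * Q, f * R)"

fun div_vf :: "vfield \<Rightarrow> ps3"
  where "div_vf (P, Q, R) = dx P + dy Q + dz R"

text \<open>
  The vector field whose derivation is the commutator \<open>v w - w v\<close>; its components are the values
  of that commutator on the coordinate functions.  That it agrees with the commutator on every
  power series is lemma \<open>act_bracket\<close> below.
\<close>

definition bracket :: "vfield \<Rightarrow> vfield \<Rightarrow> vfield"
  where "bracket v w =
    (act v (act w X) - act w (act v X),
     act v (act w Y) - act w (act v Y),
     act v (act w Z) - act w (act v Z))"

abbreviation ad :: "vfield \<Rightarrow> vfield \<Rightarrow> vfield"
  where "ad v w \<equiv> bracket v w"


section \<open>The generators and the space B\<close>

definition \<Delta> :: ps3 where "\<Delta> = X * Z - Y ^ 2"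

definition N :: vfield where "N = (0, X, 2 * Y)"
definition M :: vfield where "M = (2 * Y, Z, 0)"

text \<open>Used only for \<open>l \<le> m\<close>, so that the truncated subtraction is the true one.\<close>

definition \<kappa> :: "nat \<Rightarrow> nat \<Rightarrow> real"
  where "\<kappa> l m = fact m / fact (m - l)"

definition B :: "int \<Rightarrow> nat \<Rightarrow> nat \<Rightarrow> vfield"
  where "B l i k =
    smult_vf (const3 (1 / \<kappa> (nat (l + 1)) (2 * i + 2)))
      ((ad N ^^ nat (l + 1)) (smult_vf (Z ^ i * \<Delta> ^ k) M))"

text \<open>
  Infinite formal sums are taken coefficient by coefficient.  The restriction to nonzero
  summands makes each coefficient a finite sum for the families used here:
  \<open>B l i k\<close> is homogeneous of degree \<open>i + 2 * k + 1\<close> (lemma \<open>finite_support_B\<close> below).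
\<close>

definition formal_sum :: "('i \<Rightarrow> ps3) \<Rightarrow> 'i set \<Rightarrow> ps3"
  where "formal_sum F I = Abs_fps (\<lambda>a. Abs_fps (\<lambda>b. Abs_fps (\<lambda>c.
    \<Sum>t \<in> {t \<in> I. F t $ a $ b $ c \<noteq> 0}. F t $ a $ b $ c)))"

definition formal_sum_vf :: "('i \<Rightarrow> vfield) \<Rightarrow> 'i set \<Rightarrow> vfield"
  where "formal_sum_vf F I =
    (formal_sum (\<lambda>t. fst (F t)) I,
     formal_sum (\<lambda>t. fst (snd (F t))) I,
     formal_sum (\<lambda>t. snd (snd (F t))) I)"

definition B_index :: "(int \<times> nat \<times> nat) set"
  where "B_index = {(l, i, k). i + 2 * k \<ge> 1 \<and> - 1 \<le> l \<and> l \<le> 2 * int i + 1}"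

definition B_space :: "vfield set"
  where "B_space =
    {smult_vf (const3 c) (B 1 0 0) +
      formal_sum_vf (\<lambda>(l, i, k). smult_vf (const3 (b l i k)) (B l i k)) B_index
     | (c :: real) (b :: int \<Rightarrow> nat \<Rightarrow> nat \<Rightarrow> real). True}"


section \<open>Adequacy of the definitions\<close>

lemma coeffwise_nth [simp]: "coeffwise D f $ n = D (f $ n)"
  by (simp add: coeffwise_def)

lemma d_add: "dx (f + g) = dx f + dx g" "dy (f + g) = dy f + dy g" "dz (f + g) = dz f + dz g"
  by (simp_all add: dx_def dy_def dz_def fps_eq_iff)

lemma coeffwise_mult:
  fixes D :: "'a::comm_ring_1 \<Rightarrow> 'a"
  assumes add: "\<And>a b. D (a + b) = D a + D b"
    and mult: "\<And>a b. D (a * b) = D a * b + a * D b"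
  shows "coeffwise D (f * g) = coeffwise D f * g + f * coeffwise D g"
proof (rule fps_ext)
  fix n
  have "D 0 = 0" using add[of 0 0] by simp
  then have D_sum: "D (\<Sum>i\<in>A. h i) = (\<Sum>i\<in>A. D (h i))" for h and A :: "nat set"
    by (induction A rule: infinite_finite_induct) (auto simp: add)
  show "coeffwise D (f * g) $ n = (coeffwise D f * g + f * coeffwise D g) $ n"
    by (simp add: fps_mult_nth D_sum mult sum.distrib)
qed

lemma d_mult:
  "dx (f * g) = dx f * g + f * dx g"
  "dy (f * g) = dy f * g + f * dy g"
  "dz (f * g) = dz f * g + f * dz g"
proof -
  have dm: "fps_deriv (p * q) = fps_deriv p * q + p * fps_deriv q" for p q :: "'a::comm_ring_1 fps"
    by (simp add: add.commute)
  show "dx (f * g) = dx f * g + f * dx g"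
    unfolding dx_def by (rule dm)
  show "dy (f * g) = dy f * g + f * dy g"
    unfolding dy_def by (intro coeffwise_mult dm) simp
  show "dz (f * g) = dz f * g + f * dz g"
    unfolding dz_def by (intro coeffwise_mult dm) (simp_all add: fps_eq_iff)
qed

lemma d_commute: "dy (dx f) = dx (dy f)" "dz (dx f) = dx (dz f)" "dz (dy f) = dy (dz f)"
  by (simp_all add: dx_def dy_def dz_def fps_eq_iff flip: fps_of_nat)

lemma d_const: "dx 0 = 0" "dy 0 = 0" "dz 0 = 0" "dx 2 = 0" "dy 2 = 0" "dz 2 = 0"
  by (simp_all add: dx_def dy_def dz_def fps_eq_iff numeral_fps_const)

lemma d_coord:
  "dx X = 1" "dx Y = 0" "dx Z = 0"
  "dy X = 0" "dy Y = 1" "dy Z = 0"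
  "dz X = 0" "dz Y = 0" "dz Z = 1"
  by (simp_all add: dx_def dy_def dz_def X_def Y_def Z_def fps_eq_iff fps_X_def)

lemma d_diff: "dx (f - g) = dx f - dx g" "dy (f - g) = dy f - dy g" "dz (f - g) = dz f - dz g"
  by (simp_all add: dx_def dy_def dz_def fps_eq_iff algebra_simps)

lemma d_uminus: "dx (- f) = - dx f" "dy (- f) = - dy f" "dz (- f) = - dz f"
  by (simp_all add: dx_def dy_def dz_def fps_eq_iff)

lemma act_coord: "act (P, Q, R) X = P" "act (P, Q, R) Y = Q" "act (P, Q, R) Z = R"
  by (simp_all add: d_coord)

lemma act_bracket: "act (bracket v w) f = act v (act w f) - act w (act v f)"
proof -
  obtain P Q R P' Q' R' where v: "v = (P, Q, R)" and w: "w = (P', Q', R')"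
    by (cases v; cases w)
  have "bracket v w = (act v P' - act w P, act v Q' - act w Q, act v R' - act w R)"
    unfolding bracket_def v w act_coord ..
  then show ?thesis
    by (simp add: v w d_add d_mult d_commute algebra_simps)
qed

lemma B_0_0: "B 1 0 0 = - N"
proof -
  have "bracket N (bracket N M) = smult_vf (- 2) N"
    by (simp add: bracket_def N_def M_def d_add d_diff d_mult d_const d_coord d_uminus algebra_simps)
  moreover have "B 1 0 0 = smult_vf (const3 (1 / 2)) (bracket N (bracket N M))"
  proof -
    have "nat (1 + 1) = 2" by simp
    moreover have "\<kappa> 2 (2 * 0 + 2) = 2" by (simp add: \<kappa>_def)
    ultimately show ?thesis
      by (simp add: B_def M_def funpow.simps(2) numeral_2_eq_2 del: act.simps)
  qed
  moreover have "const3 (1 / 2) * - 2 = - 1"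
    by (simp add: const3_def numeral_fps_const flip: fps_const_neg)
  then have "smult_vf (const3 (1 / 2)) (smult_vf (- 2) v) = - v" for v
    by (cases v) (simp only: smult_vf.simps uminus_Pair mult.assoc[symmetric] mult_minus1)
  ultimately show ?thesis by (simp only:)
qed

definition homogeneous :: "nat \<Rightarrow> ps3 \<Rightarrow> bool"
  where "homogeneous d f \<longleftrightarrow> (\<forall>a b c. f $ a $ b $ c \<noteq> 0 \<longrightarrow> a + b + c = d)"

lemma homogeneous_0: "homogeneous d 0"
  by (simp add: homogeneous_def)

lemma homogeneous_add: "homogeneous d f \<Longrightarrow> homogeneous d g \<Longrightarrow> homogeneous d (f + g)"
  unfolding homogeneous_def by (metis add.right_neutral fps_add_nth)

lemma homogeneous_diff: "homogeneous d f \<Longrightarrow> homogeneous d g \<Longrightarrow> homogeneous d (f - g)"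
  unfolding homogeneous_def by (metis diff_self fps_sub_nth)

lemma homogeneous_mult:
  assumes "homogeneous d f" "homogeneous e g"
  shows "homogeneous (d + e) (f * g)"
  unfolding homogeneous_def
proof (intro allI impI)
  fix a b c
  assume nz: "(f * g) $ a $ b $ c \<noteq> 0"
  have "(f * g) $ a $ b $ c = (\<Sum>i=0..a. \<Sum>j=0..b. \<Sum>k=0..c.
      f $ i $ j $ k * g $ (a - i) $ (b - j) $ (c - k))"
    by (simp add: fps_mult_nth fps_sum_nth)
  with nz obtain i j k where "i \<le> a" "j \<le> b" "k \<le> c"
      and "f $ i $ j $ k \<noteq> 0" "g $ (a - i) $ (b - j) $ (c - k) \<noteq> 0"
    by (auto elim!: sum.not_neutral_contains_not_neutral)
  moreover from this assms have "i + j + k = d" "(a - i) + (b - j) + (c - k) = e"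
    unfolding homogeneous_def by blast+
  ultimately show "a + b + c = d + e" by linarith
qed

lemma homogeneous_const3: "homogeneous 0 (const3 r)"
  by (simp add: homogeneous_def const3_def)

lemma homogeneous_coord: "homogeneous 1 X" "homogeneous 1 Y" "homogeneous 1 Z"
  by (auto simp: homogeneous_def X_def Y_def Z_def fps_X_def split: if_splits)

lemma homogeneous_scale: "homogeneous d f \<Longrightarrow> homogeneous d (const3 r * f)"
  using homogeneous_mult[OF homogeneous_const3] by simp

lemma two_eq: "(2::ps3) = const3 2"
  by (simp add: const3_def numeral_fps_const)

lemma homogeneous_deriv:
  assumes "homogeneous (Suc d) f"
  shows "homogeneous d (dx f)" "homogeneous d (dy f)" "homogeneous d (dz f)"
  using assms
  by (auto simp: homogeneous_def dx_def dy_def dz_def simp flip: fps_of_nat) fastforce+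

lemma homogeneous_power: "homogeneous d f \<Longrightarrow> homogeneous (n * d) (f ^ n)"
proof (induction n)
  case 0
  show ?case using homogeneous_const3[of 1] by (simp add: const3_def)
next
  case (Suc n)
  then show ?case using homogeneous_mult[of d f "n * d" "f ^ n"] by simp
qed

fun homogeneous_vf :: "nat \<Rightarrow> vfield \<Rightarrow> bool"
  where "homogeneous_vf d (P, Q, R) \<longleftrightarrow> homogeneous d P \<and> homogeneous d Q \<and> homogeneous d R"

lemma homogeneous_ad_N:
  assumes "homogeneous_vf (Suc d) v"
  shows "homogeneous_vf (Suc d) (ad N v)"
proof -
  obtain P Q R where v: "v = (P, Q, R)" by (cases v)
  have N_act: "homogeneous (Suc d) (act N f)" if "homogeneous (Suc d) f" for f
    using homogeneous_mult[OF homogeneous_coord(1) homogeneous_deriv(2)[OF that]]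
      homogeneous_scale[OF homogeneous_mult[OF homogeneous_coord(2) homogeneous_deriv(3)[OF that]], of 2]
    by (auto simp: N_def two_eq mult.assoc intro!: homogeneous_add)
  have "ad N v = (act N P, act N Q - P, act N R - const3 2 * Q)"
    by (simp add: bracket_def N_def v d_coord d_mult d_const flip: two_eq)
  with assms show ?thesis
    by (auto simp: v intro!: N_act homogeneous_diff homogeneous_scale)
qed

lemma homogeneous_B: "homogeneous_vf (i + 2 * k + 1) (B l i k)"
proof -
  let ?m = "Z ^ i * \<Delta> ^ k"
  have "homogeneous 2 \<Delta>"
    unfolding \<Delta>_def power2_eq_square
    using homogeneous_mult[OF homogeneous_coord(1) homogeneous_coord(3)]
      homogeneous_mult[OF homogeneous_coord(2) homogeneous_coord(2)]
    by (auto intro!: homogeneous_diff simp: numeral_2_eq_2)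
  from homogeneous_mult[OF homogeneous_power[OF homogeneous_coord(3), of i] homogeneous_power[OF this, of k]]
  have m: "homogeneous (i + 2 * k) ?m" by (simp add: mult.commute)
  have "homogeneous_vf (Suc (i + 2 * k)) (smult_vf ?m M)"
    using homogeneous_mult[OF m homogeneous_scale[OF homogeneous_coord(2), of 2]]
      homogeneous_mult[OF m homogeneous_coord(3)]
    by (simp add: M_def two_eq homogeneous_0)
  then have "homogeneous_vf (Suc (i + 2 * k)) ((ad N ^^ n) (smult_vf ?m M))" for n
    by (induction n) (auto intro: homogeneous_ad_N)
  then show ?thesis
    unfolding B_def
    by (cases "(ad N ^^ nat (l + 1)) (smult_vf ?m M)")
      (metis Suc_eq_plus1 homogeneous_scale homogeneous_vf.simps smult_vf.simps)
qed

lemma finite_support_B: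
  fixes r :: "int \<Rightarrow> nat \<Rightarrow> nat \<Rightarrow> real"
  defines "F \<equiv> \<lambda>(l, i, k). smult_vf (const3 (r l i k)) (B l i k)"
  shows "finite {t \<in> B_index. fst (F t) $ a $ b $ c \<noteq> 0}"
    and "finite {t \<in> B_index. fst (snd (F t)) $ a $ b $ c \<noteq> 0}"
    and "finite {t \<in> B_index. snd (snd (F t)) $ a $ b $ c \<noteq> 0}"
proof -
  let ?n = "a + b + c"
  let ?S = "{- 1..2 * int ?n + 1} \<times> {..?n} \<times> {..?n}"
  have fin: "finite ?S" by simp
  have hom: "homogeneous_vf (i + 2 * k + 1) (F (l, i, k))" for l i k
    using homogeneous_B[of i k l]
    by (cases "B l i k") (simp add: F_def homogeneous_scale)
  have "t \<in> ?S" if "t \<in> B_index"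
    and nz: "fst (F t) $ a $ b $ c \<noteq> 0 \<or> fst (snd (F t)) $ a $ b $ c \<noteq> 0 \<or> snd (snd (F t)) $ a $ b $ c \<noteq> 0"
    for t
  proof -
    obtain l i k where t: "t = (l, i, k)" by (cases t)
    have "?n = i + 2 * k + 1"
      using hom[where l = l and i = i and k = k] nz unfolding t
      by (cases "F (l, i, k)") (auto simp: homogeneous_def)
    with that(1) show ?thesis by (auto simp: t B_index_def)
  qed
  then show "finite {t \<in> B_index. fst (F t) $ a $ b $ c \<noteq> 0}"
    and "finite {t \<in> B_index. fst (snd (F t)) $ a $ b $ c \<noteq> 0}"
    and "finite {t \<in> B_index. snd (snd (F t)) $ a $ b $ c \<noteq> 0}"
    by (auto intro!: finite_subset[OF _ fin])
qed

end

theory Submission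
  imports Defs
begin

text \<open>
  Divergence-free fields form a Lie algebra, because \<open>div [v, w] = v (div w) - w (div v)\<close>, and
  \<open>f w\<close> is divergence free whenever \<open>w\<close> is and \<open>w f = 0\<close>.  The fields \<open>N\<close> and \<open>M\<close> are divergence
  free and \<open>M\<close> annihilates both \<open>z\<close> and \<open>\<Delta>\<close>.  So every \<open>B l i k\<close> is divergence free, and
  divergence commutes with locally finite formal sums.
\<close>

lemma d_const3: "dx (const3 r) = 0" "dy (const3 r) = 0" "dz (const3 r) = 0"
  by (simp_all add: dx_def dy_def dz_def const3_def fps_eq_iff)

text \<open>Each coefficient of a derivative is a scalar multiple of one coefficient, shifted by one
  place; so divergence can be compared with formal sums coefficient by coefficient.\<close>

lemma d_nth:
  "dx f $ a $ b $ c = real (Suc a) * f $ Suc a $ b $ c"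
  "dy f $ a $ b $ c = real (Suc b) * f $ a $ Suc b $ c"
  "dz f $ a $ b $ c = real (Suc c) * f $ a $ b $ Suc c"
  by (simp_all add: dx_def dy_def dz_def del: of_nat_Suc flip: fps_of_nat)

lemma div_vf_components: "div_vf v = dx (fst v) + dy (fst (snd v)) + dz (snd (snd v))"
  by (cases v) simp

lemma div_vf_add: "div_vf (v + w) = div_vf v + div_vf w"
  by (cases v; cases w) (simp add: d_add)

lemma act_diff: "act v (f - g) = act v f - act v g"
  by (cases v) (simp add: d_diff algebra_simps)

lemma act_mult: "act v (f * g) = act v f * g + f * act v g"
  by (cases v) (simp add: d_mult algebra_simps)

lemma act_power_eq_0:
  assumes "act v f = 0"
  shows "act v (f ^ n) = 0"
proof (induction n)
  case 0
  \<comment> \<open>The Leibniz rule on \<open>1 * 1\<close> forces a derivation to kill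
    \<open>1\<close>.\<close>
  have "act v 1 = act v 1 + act v 1" using act_mult[of v 1 1] by simp
  then show ?case by simp
next
  case (Suc n)
  then show ?case by (simp add: act_mult assms)
qed

lemma act_const3: "act v (const3 r) = 0"
  by (cases v) (simp add: d_const3)

lemma act_0: "act v 0 = 0"
  by (cases v) (simp add: d_const)

lemma div_vf_smult: "div_vf (smult_vf f v) = act v f + f * div_vf v"
  by (cases v) (simp add: d_mult algebra_simps)

text \<open>Second-order terms assemble to the right-hand side because partial derivatives commute.
  The products of first derivatives, summed over pairs of coordinates, cancel when the two indices
  are swapped.\<close>

lemma div_vf_bracket: "div_vf (bracket v w) = act v (div_vf w) - act w (div_vf v)"
proof -
  obtain P Q R P' Q' R' where vw: "v = (P, Q, R)" "w = (P', Q', R')"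
    by (cases v; cases w)
  have "bracket v w = (act v P' - act w P, act v Q' - act w Q, act v R' - act w R)"
    unfolding bracket_def vw act_coord ..
  then show ?thesis
    by (simp add: vw d_add d_diff d_mult d_commute algebra_simps)
qed

lemma div_vf_N: "div_vf N = 0"
  by (simp add: N_def d_const d_coord d_mult)

lemma div_vf_M: "div_vf M = 0"
  by (simp add: M_def d_const d_coord d_mult)

lemma act_M_Z: "act M Z = 0"
  by (simp add: M_def d_coord)

text \<open>The \<open>X\<close> part contributes \<open>2 * Y * Z\<close> and the \<open>Y\<close>
  part its negative.\<close>

lemma act_M_\<Delta>: "act M \<Delta> = 0"
  by (simp add: M_def \<Delta>_def d_coord d_diff d_mult power2_eq_square algebra_simps)

lemma div_vf_B: "div_vf (B l i k) = 0"
proof -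
  have "div_vf ((ad N ^^ n) (smult_vf (Z ^ i * \<Delta> ^ k) M)) = 0" for n
  proof (induction n)
    case 0
    show ?case
      by (simp add: div_vf_smult div_vf_M act_mult act_power_eq_0 act_M_Z act_M_\<Delta>)
  next
    case (Suc n)
    then show ?case by (simp add: div_vf_bracket div_vf_N act_0)
  qed
  then show ?thesis
    by (simp add: B_def div_vf_smult act_const3)
qed

text \<open>Enlarging the support to \<open>S\<close> adds only zeros. This lets three component
  sums with different supports share one index set.\<close>

lemma formal_sum_nth:
  assumes "finite S" "S \<subseteq> I" "{t \<in> I. F t $ a $ b $ c \<noteq> 0} \<subseteq> S"
  shows "formal_sum F I $ a $ b $ c = (\<Sum>t\<in>S. F t $ a $ b $ c)"
  unfolding formal_sum_def using assms
  by (auto intro: sum.mono_neutral_left)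

lemma div_vf_formal_sum_eq_0:
  assumes fin: "\<And>a b c. finite {t \<in> I. fst (F t) $ a $ b $ c \<noteq> 0}"
      "\<And>a b c. finite {t \<in> I. fst (snd (F t)) $ a $ b $ c \<noteq> 0}"
      "\<And>a b c. finite {t \<in> I. snd (snd (F t)) $ a $ b $ c \<noteq> 0}"
    and div: "\<And>t. t \<in> I \<Longrightarrow> div_vf (F t) = 0"
  shows "div_vf (formal_sum_vf F I) = 0"
proof (intro fps_ext)
  fix a b c
  \<comment> \<open>Exactly three coefficients, each one degree up in its own variable, enter the
    divergence at \<open>a\<close>, \<open>b\<close>, \<open>c\<close>; \<open>S\<close> collects
    their supports.\<close>
  define S where "S = {t \<in> I. fst (F t) $ Suc a $ b $ c \<noteq> 0}
    \<union> {t \<in> I. fst (snd (F t)) $ a $ Suc b $ c \<noteq> 0}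
    \<union> {t \<in> I. snd (snd (F t)) $ a $ b $ Suc c \<noteq> 0}"
  have S: "finite S" "S \<subseteq> I"
    using fin by (auto simp: S_def)
  have sums:
    "formal_sum (\<lambda>t. fst (F t)) I $ Suc a $ b $ c = (\<Sum>t\<in>S. fst (F t) $ Suc a $ b $ c)"
    "formal_sum (\<lambda>t. fst (snd (F t))) I $ a $ Suc b $ c = (\<Sum>t\<in>S. fst (snd (F t)) $ a $ Suc b $ c)"
    "formal_sum (\<lambda>t. snd (snd (F t))) I $ a $ b $ Suc c = (\<Sum>t\<in>S. snd (snd (F t)) $ a $ b $ Suc c)"
    by (rule formal_sum_nth[OF S]; auto simp: S_def)+
  have "div_vf (formal_sum_vf F I) $ a $ b $ c = (\<Sum>t\<in>S. div_vf (F t) $ a $ b $ c)"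
    by (simp add: formal_sum_vf_def d_nth sums sum.distrib sum_distrib_left
      div_vf_components del: of_nat_Suc)
  also have "\<dots> = 0"
    using S(2) div by (intro sum.neutral) auto
  finally show "div_vf (formal_sum_vf F I) $ a $ b $ c = 0 $ a $ b $ c"
    by simp
qed

theorem theorem4p2:
  fixes v :: vfield
  assumes "v \<in> B_space"
  shows "div_vf v = 0"
proof -
  obtain c and b :: "int \<Rightarrow> nat \<Rightarrow> nat \<Rightarrow> real" where
    v: "v = smult_vf (const3 c) (B 1 0 0) +
      formal_sum_vf (\<lambda>(l, i, k). smult_vf (const3 (b l i k)) (B l i k)) B_index"
    using assms unfolding B_space_def by blast
  \<comment> \<open>Stated for all indices so as to cover also \<open>B 1 0 0\<close>, which lies
    outside \<open>B_index\<close>.\<close>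
  have scaled: "div_vf (smult_vf (const3 r) (B l i k)) = 0" for r l i k
    by (simp add: div_vf_smult act_const3 div_vf_B)
  have "div_vf (formal_sum_vf (\<lambda>(l, i, k). smult_vf (const3 (b l i k)) (B l i k)) B_index) = 0"
    by (intro div_vf_formal_sum_eq_0 finite_support_B) (auto simp: scaled)
  then show ?thesis
    by (simp add: v div_vf_add scaled)
qed

end
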